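(* The following graphs are midpoint unit veto interval (MUVI) graphs: (1) the complete bipartite graphs $K_{m,n}$ for all $m\ge1$, $n\ge1$; (2) all caterpillars; (3) the cycles $C_n$ for all $n \geq 4$.
   Context: All graphs are finite and simple. A caterpillar is a tree containing a path $s_1s_2\cdots s_k$ (the spine) such that every vertex has distance at most one from the spine. A veto interval is a triple $I(a)=(a_l,a_v,a_r)$ of reals with $a_l<a_v<a_r$. A veto interval representation of a graph $G$ assigns to each vertex $a$ a veto interval $I(a)$ such that distinct vertices $a,b$ are adjacent if and only if $a_v<b_l<a_r<b_v$ or $b_v<a_l<b_r<a_v$. It is midpoint unit if all intervals $[a_l,a_r]$ have the same length and every veto mark is the midpoint, $a_v=(a_l+a_r)/2$. A MUVI graph is a graph with a midpoint unit veto interval representation. *)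

theory Defs
  imports "Graph_Theory.Graph_Theory"
begin

text \<open>
  A finite simple graph is a symmetric digraph satisfying \<^locale>\<open>graph\<close>: each undirected edge
  is a pair of opposite arcs, and \<open>u\<close>, \<open>v\<close> are adjacent iff \<open>(u, v) \<in> arcs_ends G\<close>.
\<close>

text \<open>
  In a symmetric digraph, \<^const>\<open>pre_digraph.cycle\<close> also holds of the walk \<open>u, v, u\<close> along an
  edge, so \<^const>\<open>tree\<close> fails for every graph with an edge. The cycles of length at least 3 are
  exactly the cycles of the undirected graph.
\<close>
definition undirected_tree :: "('a, 'b) pre_digraph \<Rightarrow> bool" where
  "undirected_tree G \<longleftrightarrow> graph G \<and> Digraph_Component.connected G \<and>
     \<not> (\<exists>p. pre_digraph.cycle G p \<and> 3 \<le> length p)"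

definition graph_distance :: "('a, 'b) pre_digraph \<Rightarrow> 'a \<Rightarrow> 'a \<Rightarrow> ereal" where
  "graph_distance G u v = wf_digraph.\<mu> G (\<lambda>_. 1) u v"

definition caterpillar :: "('a, 'b) pre_digraph \<Rightarrow> bool" where
  "caterpillar G \<longleftrightarrow> undirected_tree G \<and>
     (\<exists>spine. vpath spine G \<and> (\<forall>v \<in> verts G. \<exists>s \<in> set spine. graph_distance G s v \<le> 1))"

definition cycle_graph :: "nat \<Rightarrow> ('a, 'b) pre_digraph \<Rightarrow> bool" where
  "cycle_graph n G \<longleftrightarrow> graph G \<and> 3 \<le> n \<and>
     (\<exists>f. bij_betw f {..<n} (verts G) \<and>
        arcs_ends G = (\<Union>i<n. {(f i, f (Suc i mod n)), (f (Suc i mod n), f i)}))"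

record veto_triple =
  left_end :: real
  veto_mark :: real
  right_end :: real

definition is_veto_interval :: "veto_triple \<Rightarrow> bool" where
  "is_veto_interval I \<longleftrightarrow> left_end I < veto_mark I \<and> veto_mark I < right_end I"

definition veto_adjacent :: "veto_triple \<Rightarrow> veto_triple \<Rightarrow> bool" where
  "veto_adjacent I J \<longleftrightarrow>
     (veto_mark I < left_end J \<and> left_end J < right_end I \<and> right_end I < veto_mark J) \<or>
     (veto_mark J < left_end I \<and> left_end I < right_end J \<and> right_end J < veto_mark I)"

definition veto_representation :: "('a, 'b) pre_digraph \<Rightarrow> ('a \<Rightarrow> veto_triple) \<Rightarrow> bool" where
  "veto_representation G I \<longleftrightarrow>
     (\<forall>a \<in> verts G. is_veto_interval (I a)) \<and>
     (\<forall>a \<in> verts G. \<forall>b \<in> verts G. a \<noteq> b \<longrightarrow>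
        ((a, b) \<in> arcs_ends G \<longleftrightarrow> veto_adjacent (I a) (I b)))"

definition midpoint_unit :: "('a, 'b) pre_digraph \<Rightarrow> ('a \<Rightarrow> veto_triple) \<Rightarrow> bool" where
  "midpoint_unit G I \<longleftrightarrow>
     (\<exists>len. \<forall>a \<in> verts G. right_end (I a) - left_end (I a) = len) \<and>
     (\<forall>a \<in> verts G. veto_mark (I a) = (left_end (I a) + right_end (I a)) / 2)"

definition muvi_graph :: "('a, 'b) pre_digraph \<Rightarrow> bool" where
  "muvi_graph G \<longleftrightarrow> graph G \<and> (\<exists>I. veto_representation G I \<and> midpoint_unit G I)"

end

theory Submission
  imports Defs
begin

text \<open>
  A midpoint unit representation with intervals of length \<open>2 * L\<close> amounts to a placement of the
  midpoints on the line in which two vertices are adjacent iff their distance lies strictly between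
  \<open>L\<close> and \<open>2 * L\<close>. For \<open>K\<^sub>m\<^sub>,\<^sub>n\<close> two points suffice. For a caterpillar (\<open>L = 5\<close>) the spine is placed
  at the multiples of 9 and the leaves of its \<open>i\<close>-th vertex at distance 6 from it, on the right for
  even \<open>i\<close> and on the left for odd \<open>i\<close>. For a cycle (\<open>L = 20\<close>) points with spacing 18 are adjacent
  iff they are two steps apart, which gives two interleaved paths; moving the leftmost and the
  rightmost point outwards by 3 joins the paths at both ends.
\<close>

lemma muvi_graphI:
  fixes G :: "('a, 'b) pre_digraph" and p :: "'a \<Rightarrow> int"
  assumes "graph G" and "0 < L"
    and adj: "\<And>a b. a \<in> verts G \<Longrightarrow> b \<in> verts G \<Longrightarrow>
      (a, b) \<in> arcs_ends G \<longleftrightarrow> L < \<bar>p a - p b\<bar> \<and> \<bar>p a - p b\<bar> < 2 * L"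
  shows "muvi_graph G"
proof -
  define I where "I a = \<lparr>left_end = of_int (p a - L), veto_mark = of_int (p a),
      right_end = of_int (p a + L)\<rparr>" for a
  \<comment> \<open>In the first disjunct both outer inequalities become
    \<open>L < p b - p a\<close> and the middle one \<open>p b - p a < 2 * L\<close>; the second is
    its mirror image.\<close>
  have "veto_adjacent (I a) (I b) \<longleftrightarrow> L < \<bar>p a - p b\<bar> \<and> \<bar>p a - p b\<bar> < 2 * L" for a b
    unfolding veto_adjacent_def I_def veto_triple.simps of_int_less_iff by linarith
  then have "veto_representation G I"
    using adj \<open>0 < L\<close> by (simp add: veto_representation_def is_veto_interval_def I_def)
  moreover have "midpoint_unit G I"
    by (auto simp: midpoint_unit_def I_def)
  ultimately show ?thesis
    using \<open>graph G\<close> by (auto simp: muvi_graph_def)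
qed

lemma muvi_graph_complete_bipartite:
  assumes "complete_bipartite_digraph m n G"
  shows "muvi_graph G"
proof -
  from assms obtain U V where "graph G" and UV: "verts G = U \<union> V" "U \<inter> V = {}"
    "arcs_ends G = U \<times> V \<union> V \<times> U"
    by (auto simp: complete_bipartite_digraph_def)
  \<comment> \<open>The distance 3 between the sides lies strictly between 2 and 4.\<close>
  show ?thesis
    by (rule muvi_graphI[OF \<open>graph G\<close>, of 2 "\<lambda>v. if v \<in> U then 0 else 3"]) (use UV in auto)
qed

subsection \<open>Caterpillars\<close>

text \<open>Bridges the spine, a list of vertices, and \<open>cycle\<close>, which speaks of lists
  of arcs.\<close>

lemma (in wf_digraph) vwalk_imp_awalk:
  assumes "vwalk p G"
  shows "\<exists>es. awalk (hd p) es (last p) \<and> awalk_verts (hd p) es = p"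
  using assms
proof (induction rule: vwalk_induct)
  case (Base u)
  then show ?case by (auto intro!: exI[of _ "[]"] simp: awalk_Nil_iff)
next
  case (Cons u v es)
  then obtain as e where "awalk v as (last (v # es))" "awalk_verts v as = v # es"
    and "e \<in> arcs G" "tail G e = u" "head G e = v"
    by auto
  then show ?case by (intro exI[of _ "e # as"]) (auto simp: awalk_Cons_iff)
qed

text \<open>The closing arc would give a cycle with as many arcs as \<open>p\<close> has vertices.
  Acyclicity is used below only in this form.\<close>

lemma undirected_tree_vpath_not_closed:
  assumes "undirected_tree G" "vpath p G" "3 \<le> length p"
  shows "(last p, hd p) \<notin> arcs_ends G"
proof
  assume "(last p, hd p) \<in> arcs_ends G"
  interpret graph G using assms(1) by (simp add: undirected_tree_def)
  obtain e where e: "e \<in> arcs G" "tail G e = last p" "head G e = hd p"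
    using \<open>(last p, hd p) \<in> arcs_ends G\<close> by auto
  obtain es where es: "awalk (hd p) es (last p)" "awalk_verts (hd p) es = p"
    using vwalk_imp_awalk assms(2) by blast
  have "awalk (last p) (e # es) (last p)"
    using e es by (simp add: awalk_Cons_iff)
  moreover have "distinct (tl (awalk_verts (last p) (e # es)))"
    using assms(2) e es by auto
  ultimately have "cycle (e # es)"
    by (auto simp: cycle_def)
  moreover have "length (e # es) = length p"
    using es(2) length_awalk_verts[of "hd p" es] by simp
  ultimately show False
    using assms(1,3) by (metis undirected_tree_def)
qed

text \<open>Spine segments, extended by at most two leaves, are the paths to which acyclicity gets
  applied.\<close>

lemma vpath_segment:
  assumes "vpath p G" "i \<le> j" "j < length p"
  obtains q where "vpath q G" "set q \<subseteq> set p" "hd q = p ! i" "last q = p ! j"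
    "length q = Suc (j - i)"
proof
  let ?q = "take (Suc (j - i)) (drop i p)"
  show len: "length ?q = Suc (j - i)" using assms by simp
  then have ne: "?q \<noteq> []" by auto
  have "vwalk (drop i p) G"
    using assms vwalkI_append_r[of "drop i p" "take i p" G] by (auto simp: vpath_def)
  then have "vwalk ?q G"
    using ne vwalkI_append_l by (metis append_take_drop_id)
  then show "vpath ?q G" using assms by (simp add: vpath_def)
  show "set ?q \<subseteq> set p" by (meson order_trans set_drop_subset set_take_subset)
  show "hd ?q = p ! i" using assms by (simp add: hd_drop_conv_nth)
  show "last ?q = p ! j" using assms len ne by (simp add: last_conv_nth)
qed

lemma graph_distance_le_1:
  assumes "graph G" "graph_distance G u v \<le> 1"
  shows "u = v \<or> (u, v) \<in> arcs_ends G"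
proof -
  interpret graph G by fact
  have mu: "\<mu> (\<lambda>_. 1) u v \<le> 1" using assms(2) by (simp add: graph_distance_def)
  \<comment> \<open>Unreachable vertices have infinite distance, so the bound yields reachability
    and hence a path attaining the minimum.\<close>
  then have "u \<rightarrow>\<^sup>*\<^bsub>G\<^esub> v" using shortest_path_inf[of u v "\<lambda>_. 1"] by (cases "u \<rightarrow>\<^sup>*\<^bsub>G\<^esub> v") auto
  then obtain p where p: "apath u p v" "\<mu> (\<lambda>_. 1) u v = awalk_cost (\<lambda>_. 1) p"
    using min_cost_awalk[of u v "\<lambda>_. 1"] by auto
  have "awalk_cost (\<lambda>_. 1) p = real (length p)"
    by (induction p) auto
  then have "length p \<le> 1" using p(2) mu by simp
  moreover have "awalk u p v" using p(1) by (simp add: apath_def)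
  ultimately show ?thesis
    by (cases p) (auto simp: awalk_Cons_iff awalk_Nil_iff in_arcs_imp_in_arcs_ends)
qed

lemma muvi_graph_caterpillar:
  assumes "caterpillar G"
  shows "muvi_graph G"
proof -
  from assms obtain xs where tree: "undirected_tree G" and xs: "vpath xs G"
    and near: "\<forall>v \<in> verts G. \<exists>s \<in> set xs. graph_distance G s v \<le> 1"
    by (auto simp: caterpillar_def)
  then have "graph G" by (simp add: undirected_tree_def)
  interpret graph G by fact
  let ?E = "arcs_ends G"
  note sym = graph_symmetric
  note acyclic = undirected_tree_vpath_not_closed[OF tree]

  have spine_step: "(xs ! i, xs ! Suc i) \<in> ?E" if i: "Suc i < length xs" for i
  proof -
    obtain q where q: "vpath q G" "hd q = xs ! i" "last q = xs ! Suc i" "length q = Suc (Suc 0)"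
      by (rule vpath_segment[OF xs, of i "Suc i"]) (use i in auto)
    then obtain a b where "q = [a, b]"
      by (auto simp: length_Suc_conv)
    then show ?thesis using q by (auto simp: vpath_def vwalk_def)
  qed
  have no_chord: "(xs ! i, xs ! j) \<notin> ?E" if "i + 2 \<le> j" "j < length xs" for i j
  proof
    assume "(xs ! i, xs ! j) \<in> ?E"
    obtain q where q: "vpath q G" "hd q = xs ! i" "last q = xs ! j" "length q = Suc (j - i)"
      by (rule vpath_segment[OF xs, of i j]) (use \<open>i + 2 \<le> j\<close> \<open>j < length xs\<close> in auto)
    have "3 \<le> length q" using q \<open>i + 2 \<le> j\<close> by simp
    then show False using acyclic[OF q(1)] q sym \<open>(xs ! i, xs ! j) \<in> ?E\<close> by simp
  qed
  have spine_adj: "(xs ! i, xs ! j) \<in> ?E \<longleftrightarrow> i = Suc j \<or> j = Suc i"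
    if "i < length xs" "j < length xs" for i j
  proof -
    consider "i = j" | "j = Suc i" | "i = Suc j" | "i + 2 \<le> j" | "j + 2 \<le> i" by linarith
    then show ?thesis
      using that spine_step no_chord sym adj_not_same by cases (auto, blast+)
  qed

  \<comment> \<open>Here \<open>u\<close> would close the spine segment from \<open>i\<close> to
    \<open>j\<close> into a cycle.\<close>
  have leaf_two: False
    if prems: "u \<notin> set xs" "(xs ! i, u) \<in> ?E" "(xs ! j, u) \<in> ?E" "i < j" "j < length xs" for u i j
  proof -
    obtain q where q: "vpath q G" "set q \<subseteq> set xs" "hd q = xs ! i" "last q = xs ! j"
      "length q = Suc (j - i)"
      by (rule vpath_segment[OF xs, of i j]) (use prems in auto)
    have "q \<noteq> []" using q by auto
    have "vpath (u # q) G"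
      using q that sym by (auto intro!: vpathI vwalk_wf_digraph_consI)
    moreover have "3 \<le> length (u # q)" using q that by simp
    ultimately show False using acyclic[of "u # q"] q that \<open>q \<noteq> []\<close> by simp
  qed
  \<comment> \<open>The case \<open>i = j\<close> is included: the segment is then a single vertex
    and the cycle a triangle.\<close>
  have leaf_leaf: False
    if prems: "u \<notin> set xs" "w \<notin> set xs" "(xs ! i, u) \<in> ?E" "(xs ! j, w) \<in> ?E" "(u, w) \<in> ?E"
      "i \<le> j" "j < length xs" for u w i j
  proof -
    obtain q where q: "vpath q G" "set q \<subseteq> set xs" "hd q = xs ! i" "last q = xs ! j"
      "length q = Suc (j - i)"
      by (rule vpath_segment[OF xs, of i j]) (use prems in auto)
    have "q \<noteq> []" using q by auto
    have "u \<noteq> w" using that adj_not_same by auto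
    have "vpath (u # q) G"
      using q that sym by (auto intro!: vpathI vwalk_wf_digraph_consI)
    then have "vpath (w # u # q) G"
      using q that sym \<open>u \<noteq> w\<close> by (auto intro!: vpathI vwalk_wf_digraph_consI)
    moreover have "3 \<le> length (w # u # q)" using q \<open>q \<noteq> []\<close> by simp
    ultimately show False using acyclic[of "w # u # q"] q that \<open>q \<noteq> []\<close> by simp
  qed

  \<comment> \<open>A spine vertex gets its own index, a leaf that of its spine neighbour, which is
    unique by \<open>leaf_two\<close>.\<close>
  have "\<exists>i < length xs. if v \<in> set xs then xs ! i = v else (xs ! i, v) \<in> ?E"
    if "v \<in> verts G" for v
  proof (cases "v \<in> set xs")
    case False
    then obtain s where "s \<in> set xs" "(s, v) \<in> ?E"
      using near \<open>v \<in> verts G\<close> graph_distance_le_1[OF \<open>graph G\<close>] by blast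
    then show ?thesis using False by (auto simp: in_set_conv_nth)
  qed (auto simp: in_set_conv_nth)
  then obtain ix where ix: "ix v < length xs"
      "if v \<in> set xs then xs ! ix v = v else (xs ! ix v, v) \<in> ?E" if "v \<in> verts G" for v
    by metis
  \<comment> \<open>Edges get distance 9 or 6. Nonadjacent spine vertices are at least 18 apart; a
    leaf is 3 or at least 12 from any other spine vertex; two leaves are 0, 3 or at least 15 apart.
    Without alternating sides, leaves of consecutive spine vertices would be 9 apart.\<close>
  define p :: "'a \<Rightarrow> int" where
    "p v = 9 * int (ix v) + (if v \<in> set xs then 0 else if even (ix v) then 6 else - 6)" for v

  have adj_leaf: "(a, b) \<in> ?E \<longleftrightarrow> ix a = ix b"
    if "a \<in> verts G" "b \<in> verts G" "a \<in> set xs" "b \<notin> set xs" for a b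
    using ix[of a] ix[of b] that leaf_two[of b "ix a" "ix b"] leaf_two[of b "ix b" "ix a"]
    by (cases "ix a" "ix b" rule: linorder_cases) auto
  have adj_leaf_diff: "5 < \<bar>p a - p b\<bar> \<and> \<bar>p a - p b\<bar> < 10 \<longleftrightarrow> ix a = ix b"
    if "a \<in> set xs" "b \<notin> set xs" for a b
    using that unfolding p_def by (simp add: abs_if) presburger
  show ?thesis
  proof (rule muvi_graphI[OF \<open>graph G\<close>, of 5 p])
    fix a b assume ab: "a \<in> verts G" "b \<in> verts G"
    consider "a \<in> set xs" "b \<in> set xs" | "a \<in> set xs" "b \<notin> set xs"
      | "a \<notin> set xs" "b \<in> set xs" | "a \<notin> set xs" "b \<notin> set xs" by blast
    then show "(a, b) \<in> ?E \<longleftrightarrow> 5 < \<bar>p a - p b\<bar> \<and> \<bar>p a - p b\<bar> < 2 * 5"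
    proof cases
      case 1
      then have "(a, b) \<in> ?E \<longleftrightarrow> ix a = Suc (ix b) \<or> ix b = Suc (ix a)"
        using spine_adj[of "ix a" "ix b"] ix[of a] ix[of b] ab by simp
      then show ?thesis using 1 by (auto simp: p_def)
    next
      case 2
      then show ?thesis using adj_leaf[of a b] adj_leaf_diff[of a b] ab by simp
    next
      case 3
      then show ?thesis using adj_leaf[of b a] adj_leaf_diff[of b a] ab sym
        by (auto simp: abs_minus_commute)
    next
      case 4
      then have "(a, b) \<notin> ?E"
        using leaf_leaf[of a b "ix a" "ix b"] leaf_leaf[of b a "ix b" "ix a"] ix[of a] ix[of b]
          ab sym by (cases "ix a \<le> ix b") auto
      moreover have "\<not> (5 < \<bar>p a - p b\<bar> \<and> \<bar>p a - p b\<bar> < 10)"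
        using 4 unfolding p_def
        by (cases "even (ix a)"; cases "even (ix b)"; simp add: abs_if; presburger)
      ultimately show ?thesis by simp
    qed
  qed simp
qed

subsection \<open>Cycles\<close>

text \<open>
  Numbering the points from left to right, the cycle visits \<open>0, 2, 4, \<dots>\<close> and returns through
  \<open>\<dots>, 5, 3, 1\<close>; \<open>cycle_rank n i\<close> is the number of the \<open>i\<close>-th point visited.
\<close>
definition cycle_rank :: "int \<Rightarrow> int \<Rightarrow> int" where
  "cycle_rank n i = (if 2 * i < n then 2 * i else 2 * (n - i) - 1)"

definition cycle_position :: "int \<Rightarrow> int \<Rightarrow> int" where
  "cycle_position n r = 18 * r - (if r = 0 then 3 else 0) + (if r = n - 1 then 3 else 0)"

text \<open>Two steps give 36 or 39, three or more at least 54, and one step 18, or 21 at the ends.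
  The sums 1 and \<open>2 * n - 3\<close> encode the end pairs \<open>{0, 1}\<close> and
  \<open>{n - 2, n - 1}\<close>. Since \<open>4 \<le> n\<close>, no two-step pair is stretched at
  both ends, which would give 42.\<close>

lemma cycle_position_adjacent:
  assumes "4 \<le> n" "0 \<le> r" "r < n" "0 \<le> s" "s < n"
  shows "20 < \<bar>cycle_position n r - cycle_position n s\<bar> \<and>
      \<bar>cycle_position n r - cycle_position n s\<bar> < 40 \<longleftrightarrow>
    \<bar>r - s\<bar> = 2 \<or> r + s = 1 \<or> r + s = 2 * n - 3"
  using assms unfolding cycle_position_def by (smt (verit))

text \<open>The outward half has even ranks and the returning half odd ones, so a difference of 2
  occurs only within a half. The sums 1 and \<open>2 * n - 3\<close> are the two turns.\<close>

lemma cycle_rank_adjacent: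
  assumes "4 \<le> n" "0 \<le> i" "i < n" "0 \<le> j" "j < n"
  shows "\<bar>cycle_rank n i - cycle_rank n j\<bar> = 2 \<or> cycle_rank n i + cycle_rank n j = 1 \<or>
      cycle_rank n i + cycle_rank n j = 2 * n - 3 \<longleftrightarrow>
    \<bar>i - j\<bar> = 1 \<or> \<bar>i - j\<bar> = n - 1"
  using assms by (cases "2 * i < n"; cases "2 * j < n"; simp add: cycle_rank_def; smt)

lemma cycle_rank_bounds:
  assumes "0 \<le> i" "i < n"
  shows "0 \<le> cycle_rank n i" "cycle_rank n i < n"
  using assms by (auto simp: cycle_rank_def)

lemma muvi_graph_cycle_graph:
  assumes "cycle_graph n G" "4 \<le> n"
  shows "muvi_graph G"
proof -
  from assms obtain f where "graph G" and bij: "bij_betw f {..<n} (verts G)"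
    and E: "arcs_ends G = (\<Union>i<n. {(f i, f (Suc i mod n)), (f (Suc i mod n), f i)})"
    by (auto simp: cycle_graph_def)
  define g where "g = the_inv_into {..<n} f"
  have inj: "inj_on f {..<n}" using bij by (simp add: bij_betw_def)
  have g: "g v < n" "f (g v) = v" if "v \<in> verts G" for v
    using bij that the_inv_into_into[OF inj, of v "{..<n}"] f_the_inv_into_f[OF inj, of v]
    by (auto simp: g_def bij_betw_def)
  have f_eq: "f i = f j \<longleftrightarrow> i = j" if "i < n" "j < n" for i j
    using inj that by (auto simp: inj_on_def)
  define p where "p v = cycle_position (int n) (cycle_rank (int n) (int (g v)))" for v
  show ?thesis
  proof (rule muvi_graphI[OF \<open>graph G\<close>, of 20 p])
    fix a b assume "a \<in> verts G" "b \<in> verts G"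
    then obtain i j where ij: "i < n" "j < n" "a = f i" "b = f j" "g a = i" "g b = j"
      by (metis g)
    have mod: "Suc k mod n < n" for k using \<open>4 \<le> n\<close> by simp
    have "(a, b) \<in> arcs_ends G \<longleftrightarrow> j = Suc i mod n \<or> i = Suc j mod n"
      unfolding E using ij mod f_eq by auto
    \<comment> \<open>The difference \<open>n - 1\<close> is the wrap-around edge.\<close>
    also have "\<dots> \<longleftrightarrow> \<bar>int i - int j\<bar> = 1 \<or> \<bar>int i - int j\<bar> = int n - 1"
      using ij(1,2) \<open>4 \<le> n\<close> by (auto simp: mod_Suc)
    also have "\<dots> \<longleftrightarrow> 20 < \<bar>p a - p b\<bar> \<and> \<bar>p a - p b\<bar> < 40"
      using ij \<open>4 \<le> n\<close> unfolding p_def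
      by (simp add: cycle_position_adjacent cycle_rank_bounds cycle_rank_adjacent)
    finally show "(a, b) \<in> arcs_ends G \<longleftrightarrow> 20 < \<bar>p a - p b\<bar> \<and> \<bar>p a - p b\<bar> < 2 * 20"
      by simp
  qed simp
qed

theorem theorem14:
  fixes G :: "('a, 'b) pre_digraph"
  shows "(\<forall>m n :: nat. m \<ge> 1 \<and> n \<ge> 1 \<and> complete_bipartite_digraph m n G \<longrightarrow> muvi_graph G) \<and>
    (caterpillar G \<longrightarrow> muvi_graph G) \<and>
    (\<forall>n :: nat. n \<ge> 4 \<and> cycle_graph n G \<longrightarrow> muvi_graph G)"
  using muvi_graph_complete_bipartite muvi_graph_caterpillar muvi_graph_cycle_graph by blast

end
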